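(* Let $p/q\in[0,1/2]$ be a rational number in lowest terms, with associated Haros graph $G_{p/q}$, and let $k\ge 5$ be an integer. Write the levels $\ell_{k-3}$ and $\ell_{k-2}$ of the Farey binary tree, each listed in increasing order with fractions in lowest terms, as $$\ell_{k-3}=\left\{\frac{a_i}{b_i}\right\}_{i=1}^{2^{k-5}},\qquad \ell_{k-2}=\left\{\frac{p_j}{q_j}\right\}_{j=1}^{2^{k-4}},$$ so that $$\frac{p_{2i-1}}{q_{2i-1}}<\frac{a_i}{b_i}<\frac{p_{2i}}{q_{2i}}\qquad\text{for all } i=1,\dots,2^{k-5}.$$ Then the degree distribution of $G_{p/q}$ at degree $k$ is $$P\left(k,\frac{p}{q}\right)=\begin{cases} q_{2i-1}\cdot\frac{p}{q}-p_{2i-1}, & \text{if } \frac{p}{q}\in\left(\frac{p_{2i-1}}{q_{2i-1}},\frac{a_i}{b_i}\right) \text{ for some } i\in\{1,\dots,2^{k-5}\},\\[4pt] -q_{2i}\cdot\frac{p}{q}+p_{2i}, & \text{if } \frac{p}{q}\in\left(\frac{a_i}{b_i},\frac{p_{2i}}{q_{2i}}\right) \text{ for some } i\in\{1,\dots,2^{k-5}\},\\[4pt] \frac{1}{q_j}, & \text{if } \frac{p}{q}=\frac{p_j}{q_j}\in\ell_{k-2},\\[4pt] 0, & \text{otherwise.}\end{cases}$$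
   Context: Farey binary tree levels: $\ell_1=\{0/1,1/1\}$, and for $n\ge1$ the level $\ell_{n+1}$ consists of all mediants $\frac{a+c}{b+d}$ of two fractions $\frac ab<\frac cd$ that are consecutive in the set $\ell_1\cup\dots\cup\ell_n$ (fractions in lowest terms). Thus $\ell_2=\{1/2\}$, $\ell_3=\{1/3,2/3\}$, $\ell_4=\{1/4,2/5,3/5,3/4\}$, and $|\ell_n|=2^{n-2}$ for $n\ge2$. Haros graphs: these are finite simple graphs whose nodes are linearly ordered, so that each has a first and a last node (the extreme nodes). The initial graph $G_0$ consists of two nodes joined by an edge, and $G_{0/1}=G_{1/1}=G_0$. The concatenation $G_L\oplus G_R$ is obtained from disjoint copies of $G_L$ and $G_R$ by identifying the last node of $G_L$ with the first node of $G_R$ (the degrees add), and then adding one new edge joining the first node of $G_L$ to the last node of $G_R$; the nodes of $G_L$ are ordered before those of $G_R$. Every reduced fraction $p/q\in(0,1)$ is uniquely the mediant $p/q=(a+c)/(b+d)$ of two reduced fractions $a/b<c/d$ in $[0,1]$ with $p=a+c$, $q=b+d$ and $bc-ad=1$ (its parents in the Farey binary tree). One defines recursively $G_{p/q}=G_{a/b}\oplus G_{c/d}$. The graph $G_{p/q}$ has $q+1$ nodes. Degree distribution (boundary node convention): the first and last nodes of $G_{p/q}$ are identified as a single boundary node whose degree is defined to be the sum of the degrees of the two extreme nodes in $G_{p/q}$; the other nodes keep their degree. This gives $q$ nodes in total, and $P(k,p/q)$ is the number of these $q$ nodes having degree $k$, divided by $q$. *)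

theory Defs
  imports Complex_Main
begin

section \<open>Fractions in lowest terms and mediants\<close>

definition numer :: "rat \<Rightarrow> int" where
  "numer x = fst (quotient_of x)"

definition denom :: "rat \<Rightarrow> int" where
  "denom x = snd (quotient_of x)"

definition mediant :: "rat \<Rightarrow> rat \<Rightarrow> rat" where
  "mediant x y = of_int (numer x + numer y) / of_int (denom x + denom y)"

lemma quotient_of_numer_denom: "quotient_of x = (numer x, denom x)"
  by (simp add: numer_def denom_def)

lemma denom_pos: "denom x > 0"
  using quotient_of_denom_pos[OF quotient_of_numer_denom] .

lemma coprime_numer_denom: "coprime (numer x) (denom x)"
  using quotient_of_coprime[OF quotient_of_numer_denom] .

lemma rat_eq_numer_denom: "x = of_int (numer x) / of_int (denom x)"
  using quotient_of_div[OF quotient_of_numer_denom] .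

lemma quotient_of_of_int_divide:
  assumes "b > 0" "coprime a b"
  shows "quotient_of (of_int a / of_int b) = (a, b)"
  using assms by (simp add: Fract_of_int_quotient[symmetric] quotient_of_Fract)

lemma numer_denom_of_int_divide:
  assumes "b > 0" "coprime a b"
  shows "numer (of_int a / of_int b) = a" "denom (of_int a / of_int b) = b"
  using quotient_of_of_int_divide[OF assms] by (simp_all add: numer_def denom_def)

section \<open>Levels of the Farey binary tree\<close>

definition consecutive_in :: "rat set \<Rightarrow> rat \<Rightarrow> rat \<Rightarrow> bool" where
  "consecutive_in S x y \<longleftrightarrow> x \<in> S \<and> y \<in> S \<and> x < y \<and> \<not> (\<exists>z\<in>S. x < z \<and> z < y)"

text \<open>Levels are numbered from 1; the value at 0 is a dummy.\<close>

fun farey_level :: "nat \<Rightarrow> rat set" where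
  "farey_level 0 = {}"
| "farey_level (Suc 0) = {0, 1}"
| "farey_level (Suc (Suc n)) =
     {mediant x y | x y. consecutive_in (\<Union>m\<in>{1..Suc n}. farey_level m) x y}"

text \<open>The \<open>i\<close>-th fraction (counting from 1) of level \<open>n\<close>, in increasing order.\<close>

definition farey_frac :: "nat \<Rightarrow> nat \<Rightarrow> rat" where
  "farey_frac n i = sorted_list_of_set (farey_level n) ! (i - 1)"

section \<open>Farey parents\<close>

definition is_farey_parents :: "rat \<Rightarrow> rat \<Rightarrow> rat \<Rightarrow> bool" where
  "is_farey_parents x l r \<longleftrightarrow>
     0 \<le> l \<and> l < r \<and> r \<le> 1 \<and>
     numer x = numer l + numer r \<and> denom x = denom l + denom r \<and>
     denom l * numer r - numer l * denom r = 1"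

definition farey_parents :: "rat \<Rightarrow> rat \<times> rat" where
  "farey_parents x = (THE (l, r). is_farey_parents x l r)"

lemma is_farey_parents_ex:
  assumes "0 < x" "x < 1"
  shows "\<exists>l r. is_farey_parents x l r"
proof -
  define p q where "p = numer x" and "q = denom x"
  have q: "q > 0" and cop: "coprime p q"
    using denom_pos coprime_numer_denom by (simp_all add: p_def q_def)
  have x: "x = of_int p / of_int q"
    using rat_eq_numer_denom by (simp add: p_def q_def)
  have "p > 0" "p < q"
    using assms q by (simp_all add: x zero_less_divide_iff divide_less_eq)
  obtain u v where uv: "u * p + v * q = 1"
    using cop bezout_int[of p q] by auto
  define b where "b = u mod q"
  define w where "w = u div q"
  define a where "a = - v - w * p"
  have bu: "b = u - q * w"
    by (simp add: b_def w_def minus_mult_div_eq_mod)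
  have ba: "b * p - a * q = 1"
    using uv by (simp add: bu a_def algebra_simps)
  have b: "0 \<le> b" "b < q"
    using q by (simp_all add: b_def)
  have "b \<noteq> 0"
  proof
    assume "b = 0"
    then have "q * (- a) = 1" using ba by (simp add: mult.commute)
    then have "q dvd 1" by (rule dvdI[OF sym])
    then show False using \<open>p > 0\<close> \<open>p < q\<close> by (simp add: zdvd_not_zless)
  qed
  then have "b > 0" using b by simp
  have "a * q \<ge> 0"
  proof -
    have "b * p \<ge> 1 * 1" using \<open>b > 0\<close> \<open>p > 0\<close> by (intro mult_mono) auto
    then show ?thesis using ba by simp
  qed
  then have a0: "a \<ge> 0" using q by (simp add: zero_le_mult_iff)
  have "a * q < p * q"
  proof -
    have "b * p \<le> q * p" using b \<open>p > 0\<close> by (intro mult_right_mono) auto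
    then show ?thesis using ba by (simp add: mult.commute)
  qed
  then have ap: "a < p" using q by simp
  have "a * q < b * q"
  proof -
    have "b * p \<le> b * q" using \<open>b > 0\<close> \<open>p < q\<close> by (intro mult_left_mono) auto
    then show ?thesis using ba by simp
  qed
  then have ab: "a < b" using q by simp
  define c d where "c = p - a" and "d = q - b"
  have c: "c > 0" and d: "d > 0"
    using ap b by (simp_all add: c_def d_def)
  have det: "b * c - a * d = 1"
    using ba by (simp add: c_def d_def algebra_simps)
  have "c \<le> d"
  proof (rule ccontr)
    assume "\<not> c \<le> d"
    then have "b * (d + 1) \<le> b * c" using \<open>b > 0\<close> by (intro mult_left_mono) auto
    moreover have "(a + 1) * d \<le> b * d" using ab d by (intro mult_right_mono) auto
    ultimately show False using det d \<open>b > 0\<close> by (simp add: algebra_simps)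
  qed
  have "coprime a b"
  proof (rule coprimeI)
    fix e assume "e dvd a" "e dvd b"
    then have "e dvd b * c - a * d" by (intro dvd_diff dvd_mult2)
    then show "is_unit e" by (simp add: det)
  qed
  have "coprime c d"
  proof (rule coprimeI)
    fix e assume "e dvd c" "e dvd d"
    then have "e dvd b * c - a * d" by (intro dvd_diff dvd_mult)
    then show "is_unit e" by (simp add: det)
  qed
  note ab_nd = numer_denom_of_int_divide[OF \<open>b > 0\<close> \<open>coprime a b\<close>]
  note cd_nd = numer_denom_of_int_divide[OF d \<open>coprime c d\<close>]
  have "is_farey_parents x (of_int a / of_int b) (of_int c / of_int d)"
    unfolding is_farey_parents_def ab_nd cd_nd
  proof (intro conjI)
    show "0 \<le> (of_int a / of_int b :: rat)" using a0 \<open>b > 0\<close> by simp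
    show "of_int c / of_int d \<le> (1 :: rat)" using \<open>c \<le> d\<close> d by (simp add: divide_le_eq)
    have "a * d < c * b" using det by (simp add: mult.commute)
    then have "(of_int a * of_int d :: rat) < of_int c * of_int b"
      by (metis of_int_less_iff of_int_mult)
    then show "(of_int a / of_int b :: rat) < of_int c / of_int d"
      using \<open>b > 0\<close> d by (simp add: divide_simps)
    show "numer x = a + c" by (simp add: c_def p_def)
    show "denom x = b + d" by (simp add: d_def q_def)
    show "b * c - a * d = 1" by (fact det)
  qed
  then show ?thesis by blast
qed

lemma is_farey_parents_unique:
  assumes "is_farey_parents x l r" "is_farey_parents x l' r'"
  shows "l = l' \<and> r = r'"
proof -
  define p q where "p = numer x" and "q = denom x"
  have key: "denom l * p - numer l * q = 1 \<and> 0 < denom l \<and> denom l < q"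
    if "is_farey_parents x l r" for l r
    using that denom_pos[of l] denom_pos[of r]
    by (auto simp: is_farey_parents_def p_def q_def algebra_simps)
  note k = key[OF assms(1)] and k' = key[OF assms(2)]
  have q: "q > 0" using k by simp
  have cop: "coprime q p"
    using coprime_numer_denom[of x] by (simp add: p_def q_def coprime_commute)
  have "(denom l - denom l') * p = (numer l - numer l') * q"
    using k k' by (simp add: algebra_simps)
  then have "q dvd (denom l - denom l') * p" by simp
  then have "q dvd denom l - denom l'"
    using cop by (simp add: coprime_dvd_mult_left_iff)
  then have d: "denom l = denom l'"
    using k k' zdvd_not_zless[of "denom l - denom l'" q] zdvd_not_zless[of "denom l' - denom l" q]
    by (force simp: dvd_diff_commute)
  then have "numer l * q = numer l' * q" using k k' unfolding d by linarith
  then have n: "numer l = numer l'" using q by simp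
  have "denom r = denom r'" "numer r = numer r'"
    using assms d n by (auto simp: is_farey_parents_def)
  then show ?thesis using d n rat_eq_numer_denom by metis
qed

lemma farey_parents_correct:
  assumes "0 < x" "x < 1" "farey_parents x = (l, r)"
  shows "is_farey_parents x l r"
proof -
  obtain l' r' where lr: "is_farey_parents x l' r'"
    using is_farey_parents_ex[OF assms(1,2)] by blast
  have "farey_parents x = (l', r')"
    unfolding farey_parents_def
    by (rule the_equality) (use lr is_farey_parents_unique in auto)
  then show ?thesis using lr assms(3) by simp
qed

lemma denom_farey_parents_less:
  assumes "0 < x" "x < 1" "(l, r) = farey_parents x"
  shows "denom l < denom x" "denom r < denom x"
proof -
  have "is_farey_parents x l r"
    using farey_parents_correct[OF assms(1,2) assms(3)[symmetric]] .
  then show "denom l < denom x" "denom r < denom x"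
    using denom_pos[of l] denom_pos[of r] by (auto simp: is_farey_parents_def)
qed

section \<open>Haros graphs\<close>

text \<open>
  A finite simple graph with linearly ordered nodes is represented by its
  order-preserving relabelling: the nodes are \<open>0, \<dots>, last_node G\<close> in
  their natural order, and edges are two-element sets of nodes.
\<close>

datatype ordered_graph = Ordered_Graph (last_node: nat) (edges: "nat set set")

definition initial_graph :: ordered_graph where
  "initial_graph = Ordered_Graph 1 {{0, 1}}"

text \<open>
  Shifting the right graph by \<open>last_node L\<close> keeps the two node sets disjoint except
  that the first node of the right graph is identified with the last node of the left one.
\<close>

definition concat_graph :: "ordered_graph \<Rightarrow> ordered_graph \<Rightarrow> ordered_graph"
    (infixl "\<oplus>\<^sub>H" 65) where
  "L \<oplus>\<^sub>H R =
     Ordered_Graph (last_node L + last_node R)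
       (edges L \<union> (\<lambda>e. (\<lambda>v. v + last_node L) ` e) ` edges R
        \<union> {{0, last_node L + last_node R}})"

definition degree :: "ordered_graph \<Rightarrow> nat \<Rightarrow> nat" where
  "degree G v = card {e \<in> edges G. v \<in> e}"

text \<open>Outside the open unit interval, only the values at 0 and 1 are meaningful.\<close>

function haros_graph :: "rat \<Rightarrow> ordered_graph" where
  "haros_graph x =
     (if 0 < x \<and> x < 1
      then (case farey_parents x of (l, r) \<Rightarrow> haros_graph l \<oplus>\<^sub>H haros_graph r)
      else initial_graph)"
  by auto
termination
proof (relation "measure (\<lambda>x. nat (denom x))", goal_cases)
  case 1
  show ?case by simp
next
  case (2 x)
  then show ?case using denom_farey_parents_less by (auto simp: nat_less_eq_zless denom_pos less_imp_le)
next
  case (3 x)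
  then show ?case using denom_farey_parents_less by (auto simp: nat_less_eq_zless denom_pos less_imp_le)
qed

declare haros_graph.simps [simp del]

section \<open>Degree distribution\<close>

text \<open>
  The extreme nodes are merged into one boundary node, represented by 0, so the nodes
  counted are those below \<open>last_node G\<close>.
\<close>

definition boundary_degree :: "ordered_graph \<Rightarrow> nat \<Rightarrow> nat" where
  "boundary_degree G v =
     (if v = 0 then degree G 0 + degree G (last_node G) else degree G v)"

definition degree_dist :: "nat \<Rightarrow> rat \<Rightarrow> rat" where
  "degree_dist k x =
     of_nat (card {v. v < last_node (haros_graph x) \<and> boundary_degree (haros_graph x) v = k})
       / of_int (denom x)"

end

theory Submission
  imports Defs
begin

text \<open>
  Call the sum of the first and the last degree of \<open>G\<^sub>x\<close> the outer degree of \<open>x\<close>; this is the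
  degree of the boundary node. Let \<open>x\<close> have the Farey parents \<open>l < r\<close>. Apart from the case
  \<open>x = 1/2\<close>, one parent is itself a child of the other. It follows that the outer degree of \<open>x\<close>
  is one more than the larger outer degree of the parents, while the only new inner node, where
  \<open>G\<^sub>l\<close> and \<open>G\<^sub>r\<close> are glued, has a degree one more than the smaller one
  (\<open>outer_degree_mediant\<close>). So the outer degree measures depth in the tree: for \<open>n \<ge> 2\<close>, level
  \<open>n\<close> consists of the fractions of outer degree \<open>n + 2\<close> (\<open>farey_level_eq\<close>). In particular the
  boundary node has degree \<open>k\<close> exactly on level \<open>k - 2\<close>, and an inner node of degree \<open>k\<close> is
  created exactly at the mediants whose shallower parent lies on level \<open>k - 3\<close>.

  To count these inner nodes, let \<open>u < v\<close> be Farey neighbours whose larger outer degree is \<open>k\<close>.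
  The number \<open>N y\<close> of inner nodes of degree \<open>k\<close>, plus \<open>1\<close> if \<open>y\<close> has outer degree \<open>k - 1\<close>, is
  additive along mediants in \<open>[u, v]\<close>, hence linear in the numerator and denominator of \<open>y\<close> and
  determined by its values at \<open>u\<close> and \<open>v\<close> (\<open>interior_count_between\<close>). If one of \<open>u\<close>, \<open>v\<close> is a
  fraction \<open>c\<close> of level \<open>k - 3\<close>, then the other one is a child of \<open>c\<close>, and strictly between them
  \<open>N y\<close> is the determinant of \<open>y\<close> and that child; dividing by the denominator of \<open>y\<close> gives the
  two linear branches. In all other gaps, and at all fractions up to level \<open>k - 2\<close>, there is no such node.

  It remains to match this with the enumeration of the levels: the children of the fractions of
  level \<open>k - 3\<close>, taken in order, list level \<open>k - 2\<close> in order (\<open>sorted_farey_row\<close>), so the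
  children of the \<open>i\<close>-th fraction carry the indices \<open>2 i - 1\<close> and \<open>2 i\<close>.
\<close>

section \<open>Farey neighbours\<close>

definition fdet :: "rat \<Rightarrow> rat \<Rightarrow> int" where
  "fdet x y = denom x * numer y - numer x * denom y"

definition farey_neighbours :: "rat \<Rightarrow> rat \<Rightarrow> bool" where
  "farey_neighbours l r \<longleftrightarrow> 0 \<le> l \<and> r \<le> 1 \<and> fdet l r = 1"

lemma numer_denom_0_1 [simp]: "numer 0 = 0" "denom 0 = 1" "numer 1 = 1" "denom 1 = 1"
  by (simp_all add: numer_def denom_def)

lemma fdet_pos_iff: "0 < fdet x y \<longleftrightarrow> x < y"
proof -
  have "x < y \<longleftrightarrow> (of_int (numer x) / of_int (denom x) :: rat) < of_int (numer y) / of_int (denom y)"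
    using rat_eq_numer_denom[of x] rat_eq_numer_denom[of y] by simp
  also have "\<dots> \<longleftrightarrow> (of_int (numer x * denom y) :: rat) < of_int (numer y * denom x)"
    using denom_pos[of x] denom_pos[of y] by (simp add: divide_simps)
  also have "\<dots> \<longleftrightarrow> numer x * denom y < numer y * denom x"
    by (simp only: of_int_less_iff)
  finally show ?thesis by (auto simp: fdet_def mult.commute)
qed

lemma fdet_self [simp]: "fdet x x = 0"
  by (simp add: fdet_def)

lemma farey_neighbours_less: "farey_neighbours l r \<Longrightarrow> l < r"
  by (simp add: farey_neighbours_def flip: fdet_pos_iff)

lemma is_farey_parents_iff:
  "is_farey_parents x l r \<longleftrightarrow>
     farey_neighbours l r \<and> numer x = numer l + numer r \<and> denom x = denom l + denom r"
  using farey_neighbours_less[of l r]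
  by (auto simp: is_farey_parents_def farey_neighbours_def fdet_def)

lemma fdet_mediant:
  assumes "is_farey_parents x l r"
  shows "fdet y x = fdet y l + fdet y r" "fdet x y = fdet l y + fdet r y"
  using assms by (simp_all add: is_farey_parents_iff fdet_def algebra_simps)

lemma farey_parents_neighbours:
  assumes "is_farey_parents x l r"
  shows "farey_neighbours l r" "farey_neighbours l x" "farey_neighbours x r"
proof -
  show lr: "farey_neighbours l r" using assms by (simp add: is_farey_parents_iff)
  have d: "fdet l x = 1" "fdet x r = 1"
    using lr by (simp_all add: fdet_mediant[OF assms] farey_neighbours_def)
  then have "l < x" "x < r" by (simp_all flip: fdet_pos_iff)
  then show "farey_neighbours l x" "farey_neighbours x r"
    using lr d by (simp_all add: farey_neighbours_def)
qed

lemma farey_parents_less: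
  assumes "is_farey_parents x l r"
  shows "l < x" "x < r" "0 \<le> l" "r \<le> 1"
  using farey_parents_neighbours[OF assms] farey_neighbours_less
  by (auto simp: farey_neighbours_def)

lemma farey_parents_mediant: "is_farey_parents x l r \<Longrightarrow> x = mediant l r"
  using rat_eq_numer_denom[of x] by (simp add: is_farey_parents_iff mediant_def)

lemma mediant_farey_parents:
  assumes "farey_neighbours l r"
  shows "is_farey_parents (mediant l r) l r"
proof -
  have "denom l * (numer l + numer r) - numer l * (denom l + denom r) = 1"
    using assms by (simp add: farey_neighbours_def fdet_def algebra_simps)
  then have "coprime (numer l + numer r) (denom l + denom r)"
    by (intro coprimeI) (metis dvd_diff dvd_mult)
  then show ?thesis
    using assms denom_pos[of l] denom_pos[of r]
    by (simp add: is_farey_parents_iff mediant_def numer_denom_of_int_divide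
             del: of_int_add)
qed

text \<open>The recursion of Haros graphs, as an induction principle on the unit interval.\<close>

lemma farey_induct [consumes 2, case_names zero one mediant]:
  assumes "0 \<le> x" "x \<le> 1"
    and "P 0" "P 1"
    and step: "\<And>x l r. is_farey_parents x l r \<Longrightarrow> P l \<Longrightarrow> P r \<Longrightarrow> P x"
  shows "P x"
  using assms(1,2)
proof (induction "nat (denom x)" arbitrary: x rule: less_induct)
  case less
  show ?case
  proof (cases "x = 0 \<or> x = 1")
    case True
    then show ?thesis using assms by blast
  next
    case False
    then obtain l r where p: "is_farey_parents x l r"
      using less.prems is_farey_parents_ex[of x] by auto
    have "denom x = denom l + denom r" using p by (simp add: is_farey_parents_iff)
    then have "nat (denom l) < nat (denom x)" "nat (denom r) < nat (denom x)"
      using denom_pos[of l] denom_pos[of r] by simp_all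
    then show ?thesis
      using farey_parents_less[OF p] by (intro step[OF p] less.hyps) auto
  qed
qed

text \<open>
  For neighbours \<open>l\<close> and \<open>r\<close> the denominator of \<open>y\<close> is
  \<open>fdet l y * denom r + fdet y r * denom l\<close>, and both determinants are positive integers
  when \<open>y\<close> lies strictly between.
\<close>

lemma denom_between_farey_neighbours:
  assumes "farey_neighbours l r" "l < y" "y < r"
  shows "denom l + denom r \<le> denom y"
proof -
  have "denom y = denom y * fdet l r"
    using assms(1) by (simp add: farey_neighbours_def)
  also have "\<dots> = fdet l y * denom r + fdet y r * denom l"
    by (simp add: fdet_def algebra_simps)
  finally have y: "denom y = fdet l y * denom r + fdet y r * denom l" .
  have "1 \<le> fdet l y" "1 \<le> fdet y r"
    using assms fdet_pos_iff[of l y] fdet_pos_iff[of y r] by auto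
  then have "1 * denom r \<le> fdet l y * denom r" "1 * denom l \<le> fdet y r * denom l"
    using denom_pos[of l] denom_pos[of r] by (intro mult_right_mono; simp)+
  then show ?thesis using y by simp
qed

text \<open>
  If the left parent \<open>l'\<close> of \<open>y\<close> were below \<open>l\<close>, then \<open>l\<close> would lie strictly between the
  neighbours \<open>l'\<close> and \<open>y\<close> and so have a larger denominator than \<open>y\<close>, while \<open>y\<close> lies strictly
  between \<open>l\<close> and \<open>r\<close>.
\<close>

lemma farey_parents_between:
  assumes "farey_neighbours l r" "l < y" "y < r" "is_farey_parents y l' r'"
  shows "l \<le> l'" "r' \<le> r"
proof -
  note y = denom_between_farey_neighbours[OF assms(1-3)] denom_pos[of l] denom_pos[of r]
  note p = farey_parents_neighbours[OF assms(4)]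
  show "l \<le> l'"
    using denom_between_farey_neighbours[OF p(2), of l] y denom_pos[of l'] assms(2)
    by (force simp: not_le[symmetric])
  show "r' \<le> r"
    using denom_between_farey_neighbours[OF p(3), of r] y denom_pos[of r'] assms(3)
    by (force simp: not_le[symmetric])
qed

text \<open>
  Subtracting numerators and denominators of the neighbour with the smaller denominator from
  those of the other one yields the missing parent; equal denominators leave only the pair
  \<open>0, 1\<close>.
\<close>

lemma farey_neighbours_cases:
  assumes "farey_neighbours l r"
  obtains (unit) "l = 0" "r = 1"
    | (right) r' where "is_farey_parents r l r'"
    | (left) l' where "is_farey_parents l l' r"
proof -
  note result = that
  have det: "denom l * numer r - numer l * denom r = 1" and b: "0 \<le> l" "r \<le> 1" "l < r"
    using assms farey_neighbours_less[OF assms] by (simp_all add: farey_neighbours_def fdet_def)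
  have "l = 0 \<or> (\<exists>l' r'. is_farey_parents l l' r')"
    using is_farey_parents_ex[of l] b by fastforce
  moreover have "r = 1 \<or> (\<exists>l' r'. is_farey_parents r l' r')"
    using is_farey_parents_ex[of r] b by fastforce
  moreover have ?thesis if p: "is_farey_parents r l' r'" "denom l \<le> denom r" for l' r'
  proof -
    note q = farey_parents_neighbours[OF p(1)] farey_parents_less[OF p(1)]
    have "denom r = denom l' + denom r'" using p by (simp add: is_farey_parents_iff)
    then have "\<not> (l' < l)"
      using denom_between_farey_neighbours[OF q(2), of l] b p(2) denom_pos[of l'] by auto
    moreover have "\<not> (l < l')"
      using denom_between_farey_neighbours[OF assms, of l'] q(4)
        \<open>denom r = denom l' + denom r'\<close> denom_pos[of l] denom_pos[of r'] by auto
    ultimately have "l' = l" by simp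
    then show ?thesis using result(2) p(1) by simp
  qed
  moreover have ?thesis if p: "is_farey_parents l l' r'" "denom r \<le> denom l" for l' r'
  proof -
    note q = farey_parents_neighbours[OF p(1)] farey_parents_less[OF p(1)]
    have "denom l = denom l' + denom r'" using p by (simp add: is_farey_parents_iff)
    then have "\<not> (r < r')"
      using denom_between_farey_neighbours[OF q(3), of r] b p(2) denom_pos[of r'] by auto
    moreover have "\<not> (r' < r)"
      using denom_between_farey_neighbours[OF assms, of r'] q(5)
        \<open>denom l = denom l' + denom r'\<close> denom_pos[of r] denom_pos[of l'] by auto
    ultimately have "r' = r" by simp
    then show ?thesis using result(3) p(1) by simp
  qed
  moreover have "denom 0 \<le> denom y" "denom 1 \<le> denom y" for y
    using denom_pos[of y] by simp_all
  ultimately show ?thesis using result(1) by (metis linear)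
qed

section \<open>Degrees in Haros graphs\<close>

definition proper_graph :: "ordered_graph \<Rightarrow> bool" where
  "proper_graph G \<longleftrightarrow> 0 < last_node G \<and>
     (\<forall>e\<in>edges G. \<exists>u v. e = {u, v} \<and> u < v \<and> v \<le> last_node G)"

lemma proper_graph_finite:
  assumes "proper_graph G"
  shows "finite (edges G)"
proof (rule finite_subset)
  show "edges G \<subseteq> Pow {..last_node G}"
    using assms by (fastforce simp: proper_graph_def)
qed simp

lemma proper_graph_concat:
  assumes "proper_graph L" "proper_graph R"
  shows "proper_graph (L \<oplus>\<^sub>H R)"
proof -
  have "\<exists>u v. e = {u, v} \<and> u < v \<and> v \<le> last_node L + last_node R"
    if e: "e \<in> edges (L \<oplus>\<^sub>H R)" for e
  proof -
    consider "e \<in> edges L" | e' where "e' \<in> edges R" "e = (\<lambda>v. v + last_node L) ` e'"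
      | "e = {0, last_node L + last_node R}"
      using e by (auto simp: concat_graph_def)
    then show ?thesis
    proof cases
      case 1
      then show ?thesis using assms(1) by (meson proper_graph_def trans_le_add1)
    next
      case 2
      then obtain u v where "e' = {u, v}" "u < v" "v \<le> last_node R"
        using assms(2) by (auto simp: proper_graph_def)
      then show ?thesis
        using 2 by (intro exI[of _ "u + last_node L"] exI[of _ "v + last_node L"]) auto
    next
      case 3
      then show ?thesis using assms(1) by (auto simp: proper_graph_def)
    qed
  qed
  then show ?thesis using assms by (auto simp: proper_graph_def concat_graph_def)
qed

lemma last_node_concat: "last_node (L \<oplus>\<^sub>H R) = last_node L + last_node R"
  by (simp add: concat_graph_def)

text \<open>
  The three edge sets of a concatenation are disjoint because every edge has two distinct ends:
  an edge of \<open>L\<close> meets the shifted copy of \<open>R\<close> in at most one node, and only the new edge joins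
  the two extreme nodes.
\<close>

lemma degree_concat:
  assumes "proper_graph L" "proper_graph R"
  shows "degree (L \<oplus>\<^sub>H R) v =
    (if v \<le> last_node L then degree L v else 0) +
    (if last_node L \<le> v then degree R (v - last_node L) else 0) +
    (if v = 0 \<or> v = last_node L + last_node R then 1 else 0)"
proof -
  define s where "s = (\<lambda>e. (\<lambda>v. v + last_node L) ` e)"
  define A where "A = {e \<in> edges L. v \<in> e}"
  define B where "B = {e \<in> s ` edges R. v \<in> e}"
  define C where "C = {e \<in> {{0, last_node L + last_node R}}. v \<in> e}"
  have fin: "finite A" "finite B" "finite C"
    using assms[THEN proper_graph_finite] by (simp_all add: A_def B_def C_def)
  have L: "e \<subseteq> {..last_node L}" if "e \<in> edges L" for e
    using assms(1) that by (fastforce simp: proper_graph_def)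
  have pos: "0 < last_node L" "0 < last_node R" using assms by (auto simp: proper_graph_def)
  have R: "\<not> e \<subseteq> {..last_node L} \<and> 0 \<notin> e" if "e \<in> s ` edges R" for e
  proof -
    obtain e' where e': "e' \<in> edges R" "e = s e'" using \<open>e \<in> s ` edges R\<close> by auto
    obtain u w where "e' = {u, w}" "u < w"
      using assms(2) e'(1) by (auto simp: proper_graph_def)
    then show ?thesis using e'(2) pos by (auto simp: s_def)
  qed
  have "A \<inter> B = {}"
  proof -
    have "False" if "e \<in> A" "e \<in> B" for e
      using L[of e] R[of e] that by (simp add: A_def B_def)
    then show ?thesis by blast
  qed
  moreover have "(A \<union> B) \<inter> C = {}"
  proof -
    have "{0, last_node L + last_node R} \<notin> edges L"
      using L[of "{0, last_node L + last_node R}"] pos by auto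
    moreover have "{0, last_node L + last_node R} \<notin> s ` edges R"
      using R[of "{0, last_node L + last_node R}"] by blast
    ultimately show ?thesis by (auto simp: A_def B_def C_def)
  qed
  moreover have "{e \<in> edges (L \<oplus>\<^sub>H R). v \<in> e} = A \<union> B \<union> C"
    by (auto simp: concat_graph_def A_def B_def C_def s_def)
  ultimately have "degree (L \<oplus>\<^sub>H R) v = card A + card B + card C"
    using fin by (simp add: degree_def card_Un_disjoint)
  moreover have "card A = (if v \<le> last_node L then degree L v else 0)"
  proof -
    have "A = {}" if "\<not> v \<le> last_node L" using that L by (auto simp: A_def)
    moreover have "card A = degree L v" by (simp add: A_def degree_def)
    ultimately show ?thesis by auto
  qed
  moreover have "card B = (if last_node L \<le> v then degree R (v - last_node L) else 0)"
  proof -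
    have "B = s ` {e \<in> edges R. last_node L \<le> v \<and> v - last_node L \<in> e}"
      by (force simp: B_def s_def)
    moreover have "inj s" by (auto simp: s_def inj_image_eq_iff intro!: injI)
    ultimately have "card B = card {e \<in> edges R. last_node L \<le> v \<and> v - last_node L \<in> e}"
      by (simp add: card_image inj_on_subset)
    then show ?thesis by (simp add: degree_def)
  qed
  moreover have "card C = (if v = 0 \<or> v = last_node L + last_node R then 1 else 0)"
  proof -
    have "C = (if v = 0 \<or> v = last_node L + last_node R
        then {{0, last_node L + last_node R}} else {})"
      by (auto simp: C_def)
    then show ?thesis by simp
  qed
  ultimately show ?thesis by simp
qed

lemma haros_graph_0_1: "haros_graph 0 = initial_graph" "haros_graph 1 = initial_graph"
  by (simp_all add: haros_graph.simps)

lemma haros_graph_mediant: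
  assumes "is_farey_parents x l r"
  shows "haros_graph x = haros_graph l \<oplus>\<^sub>H haros_graph r"
proof -
  have x: "0 < x" "x < 1" using farey_parents_less[OF assms] by auto
  obtain l' r' where p: "farey_parents x = (l', r')" by fastforce
  then have "l' = l" "r' = r"
    using farey_parents_correct[OF x p] is_farey_parents_unique[OF assms] by auto
  then show ?thesis using x p by (subst haros_graph.simps) simp
qed

lemma proper_haros_graph:
  assumes "0 \<le> x" "x \<le> 1"
  shows "proper_graph (haros_graph x)"
  using assms
proof (induction x rule: farey_induct)
  case (mediant x l r)
  then show ?case by (simp add: haros_graph_mediant[OF mediant.hyps] proper_graph_concat)
qed (auto simp: haros_graph_0_1 initial_graph_def proper_graph_def)

definition first_degree :: "rat \<Rightarrow> nat" where
  "first_degree x = degree (haros_graph x) 0"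

definition last_degree :: "rat \<Rightarrow> nat" where
  "last_degree x = degree (haros_graph x) (last_node (haros_graph x))"

definition outer_degree :: "rat \<Rightarrow> nat" where
  "outer_degree x = first_degree x + last_degree x"

definition interior_count :: "nat \<Rightarrow> rat \<Rightarrow> nat" where
  "interior_count k x =
     card {v. 0 < v \<and> v < last_node (haros_graph x) \<and> degree (haros_graph x) v = k}"

lemma degree_initial_graph: "degree initial_graph 0 = 1" "degree initial_graph (Suc 0) = 1"
proof -
  have "{e \<in> {{0, 1 :: nat}}. v \<in> e} = {{0, 1}}" if "v = 0 \<or> v = 1" for v
    using that by auto
  then show "degree initial_graph 0 = 1" "degree initial_graph (Suc 0) = 1"
    by (simp_all add: degree_def initial_graph_def)
qed

lemma degrees_0_1 [simp]:
  "first_degree 0 = 1" "last_degree 0 = 1" "first_degree 1 = 1" "last_degree 1 = 1"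
  "outer_degree 0 = 2" "outer_degree 1 = 2"
  using degree_initial_graph
  by (simp_all add: outer_degree_def first_degree_def last_degree_def haros_graph_0_1
        initial_graph_def)

lemma interior_count_0_1 [simp]: "interior_count k 0 = 0" "interior_count k 1 = 0"
  by (auto simp: interior_count_def haros_graph_0_1 initial_graph_def)

context
  fixes x l r :: rat
  assumes parents: "is_farey_parents x l r"
begin

lemma parents_proper:
  "proper_graph (haros_graph l)" "proper_graph (haros_graph r)"
  using farey_parents_less[OF parents] by (auto intro!: proper_haros_graph)

lemma first_degree_mediant: "first_degree x = first_degree l + 1"
  using parents_proper
  by (simp add: first_degree_def haros_graph_mediant[OF parents] degree_concat proper_graph_def)

lemma last_degree_mediant: "last_degree x = last_degree r + 1"
  using parents_proper
  by (simp add: last_degree_def haros_graph_mediant[OF parents] degree_concat last_node_concat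
      proper_graph_def)

lemma interior_count_mediant:
  "interior_count k x =
     interior_count k l + interior_count k r + of_bool (last_degree l + first_degree r = k)"
proof -
  define L R where "L = haros_graph l" and "R = haros_graph r"
  define a b where "a = last_node L" and "b = last_node R"
  define I where "I = (\<lambda>G. {v. 0 < v \<and> v < last_node G \<and> degree G v = k})"
  define M where "M = {v. v = a \<and> last_degree l + first_degree r = k}"
  have pos: "0 < a" "0 < b"
    using parents_proper by (simp_all add: a_def b_def L_def R_def proper_graph_def)
  note deg = degree_concat[OF parents_proper, folded L_def R_def, folded a_def b_def]
  have mid: "degree (L \<oplus>\<^sub>H R) a = last_degree l + first_degree r"
  proof -
    have "degree (L \<oplus>\<^sub>H R) a = degree L a + degree R 0" using pos by (simp add: deg)
    then show ?thesis by (simp add: last_degree_def first_degree_def L_def R_def a_def)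
  qed
  have "I (L \<oplus>\<^sub>H R) = I L \<union> (\<lambda>v. v + a) ` I R \<union> M" (is "?S = ?T")
  proof (intro set_eqI)
    fix v
    have last: "last_node (L \<oplus>\<^sub>H R) = a + b" by (simp add: last_node_concat a_def b_def)
    have shift: "v \<in> (\<lambda>v. v + a) ` I R \<longleftrightarrow> a \<le> v \<and> v - a \<in> I R"
      by (auto intro!: image_eqI[of _ _ "v - a"])
    consider "v < a" | "v = a" | "a < v" by linarith
    then show "v \<in> ?S \<longleftrightarrow> v \<in> ?T"
    proof cases
      case 1
      then show ?thesis unfolding Un_iff shift by (auto simp: I_def M_def deg last a_def[symmetric])
    next
      case 2
      then show ?thesis
        unfolding Un_iff shift using pos mid by (simp add: I_def M_def last a_def[symmetric])
    next
      case 3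
      then show ?thesis
        unfolding Un_iff shift by (auto simp: I_def M_def deg last a_def[symmetric] b_def[symmetric])
    qed
  qed
  moreover have "finite (I L)" "finite (I R)" "finite M"
    by (simp_all add: I_def M_def)
  moreover have "I L \<inter> (\<lambda>v. v + a) ` I R = {}" "(I L \<union> (\<lambda>v. v + a) ` I R) \<inter> M = {}"
    by (auto simp: I_def M_def a_def)
  ultimately have "card (I (L \<oplus>\<^sub>H R)) = card (I L) + card (I R) + card M"
    by (simp add: card_Un_disjoint card_image)
  moreover have "card M = of_bool (last_degree l + first_degree r = k)"
    by (simp add: M_def)
  ultimately show ?thesis
    by (simp add: interior_count_def I_def haros_graph_mediant[OF parents] L_def R_def)
qed

end

lemma degree_dist_eq:
  assumes "0 \<le> x" "x \<le> 1"
  shows "degree_dist k x =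
    of_nat (interior_count k x + of_bool (outer_degree x = k)) / of_int (denom x)"
proof -
  define G where "G = haros_graph x"
  have pos: "0 < last_node G"
    using proper_haros_graph[OF assms] by (simp add: G_def proper_graph_def)
  have "{v. v < last_node G \<and> boundary_degree G v = k} =
      {v. 0 < v \<and> v < last_node G \<and> degree G v = k} \<union> {v. v = 0 \<and> outer_degree x = k}"
    using pos
    by (auto simp: boundary_degree_def outer_degree_def first_degree_def last_degree_def G_def)
  also have "card \<dots> = interior_count k x + of_bool (outer_degree x = k)"
    by (subst card_Un_disjoint) (auto simp: interior_count_def G_def)
  finally show ?thesis by (simp add: degree_dist_def G_def)
qed

section \<open>The outer degree measures depth in the tree\<close>

text \<open>
  Unless \<open>x = 1/2\<close>, the deeper parent of \<open>x\<close> is itself a child of the shallower one, so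
  concatenating with the shallower graph raises its outer degree by exactly one.
\<close>

lemma outer_degree_parents_less:
  assumes "0 \<le> x" "x \<le> 1" "is_farey_parents x l r"
  shows "outer_degree l < outer_degree x \<and> outer_degree r < outer_degree x"
  using assms
proof (induction x arbitrary: l r rule: farey_induct)
  case (mediant x l' r')
  have [simp]: "l' = l" "r' = r"
    using is_farey_parents_unique[OF mediant.hyps mediant.prems] by auto
  note d = first_degree_mediant last_degree_mediant outer_degree_def
  note p = mediant.prems
  from farey_parents_neighbours(1)[OF p] show ?case
  proof (cases rule: farey_neighbours_cases)
    case unit
    then show ?thesis using d(1,2)[OF p] by (simp add: d(3))
  next
    case (right s)
    then have "outer_degree l < outer_degree r" using mediant.IH(2) by auto
    then show ?thesis using d(1,2)[OF p] d(1)[OF right] by (simp add: d(3))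
  next
    case (left s)
    then have "outer_degree r < outer_degree l" using mediant.IH(1) by auto
    then show ?thesis using d(1,2)[OF p] d(2)[OF left] by (simp add: d(3))
  qed
next
  case zero
  then show ?case using farey_parents_less[of 0 l r] by simp
next
  case one
  then show ?case using farey_parents_less[of 1 l r] by simp
qed

lemma outer_degree_parent_less:
  assumes "is_farey_parents x l r"
  shows "outer_degree l < outer_degree x" "outer_degree r < outer_degree x"
  using outer_degree_parents_less[OF _ _ assms] farey_parents_less[OF assms] by auto

text \<open>
  The new inner node of \<open>x\<close> records the shallower parent: if \<open>r\<close> is a child of \<open>l\<close>, its first
  degree exceeds that of \<open>l\<close> by one, so the node where \<open>l\<close> and \<open>r\<close> are glued has one more than
  the outer degree of \<open>l\<close>.
\<close>

lemma outer_degree_mediant: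
  assumes "is_farey_parents x l r" "\<not> (l = 0 \<and> r = 1)"
  shows "outer_degree x = max (outer_degree l) (outer_degree r) + 1"
    and "last_degree l + first_degree r = min (outer_degree l) (outer_degree r) + 1"
proof -
  note d = first_degree_mediant last_degree_mediant outer_degree_def
  have "outer_degree x = max (outer_degree l) (outer_degree r) + 1 \<and>
    last_degree l + first_degree r = min (outer_degree l) (outer_degree r) + 1"
    using farey_parents_neighbours(1)[OF assms(1)]
  proof (cases rule: farey_neighbours_cases)
    case unit
    then show ?thesis using assms(2) by simp
  next
    case (right s)
    then show ?thesis
      using outer_degree_parent_less[OF right] d(1,2)[OF assms(1)] d(1)[OF right]
      by (simp add: d(3))
  next
    case (left s)
    then show ?thesis
      using outer_degree_parent_less[OF left] d(1,2)[OF assms(1)] d(2)[OF left]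
      by (simp add: d(3))
  qed
  then show "outer_degree x = max (outer_degree l) (outer_degree r) + 1"
    "last_degree l + first_degree r = min (outer_degree l) (outer_degree r) + 1" by simp_all
qed

lemma outer_degree_neighbours_neq:
  assumes "farey_neighbours l r" "\<not> (l = 0 \<and> r = 1)"
  shows "outer_degree l \<noteq> outer_degree r"
  using assms(1)
proof (cases rule: farey_neighbours_cases)
  case unit
  then show ?thesis using assms(2) by simp
qed (auto dest: outer_degree_parent_less)

lemma outer_degree_half:
  assumes "is_farey_parents x 0 1"
  shows "outer_degree x = 4"
  using first_degree_mediant[OF assms] last_degree_mediant[OF assms]
  by (simp add: outer_degree_def)

text \<open>
  The parents of a fraction inside a gap between neighbours stay in the closed gap, and outer
  degrees grow from parent to child.
\<close>

lemma outer_degree_between: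
  assumes "0 \<le> y" "y \<le> 1" "farey_neighbours l r" "l < y" "y < r"
  shows "max (outer_degree l) (outer_degree r) < outer_degree y"
  using assms
proof (induction y rule: farey_induct)
  case (mediant y l' r')
  note b = farey_parents_between[OF mediant.prems mediant.hyps]
  note p = farey_parents_less[OF mediant.hyps] outer_degree_parent_less[OF mediant.hyps]
  have "outer_degree l \<le> outer_degree l'"
    using mediant.IH(1) mediant.prems b(1) p by (cases "l = l'") auto
  moreover have "outer_degree r \<le> outer_degree r'"
    using mediant.IH(2) mediant.prems b(2) p by (cases "r = r'") auto
  ultimately show ?case using p by simp
qed (auto simp: farey_neighbours_def)

lemma outer_degree_mediant_least:
  assumes "is_farey_parents x l r" "l < y" "y < r"
  shows "outer_degree x \<le> outer_degree y"
proof -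
  note p = farey_parents_neighbours[OF assms(1)] farey_parents_less[OF assms(1)]
  have y: "0 \<le> y" "y \<le> 1" using p assms by auto
  show ?thesis
    using outer_degree_between[OF y p(2)] outer_degree_between[OF y p(3)] assms(2,3)
    by (cases x y rule: linorder_cases) auto
qed

lemma outer_degree_ge_4:
  assumes "0 < x" "x < 1"
  shows "4 \<le> outer_degree x"
proof -
  have "farey_neighbours 0 1" by (simp add: farey_neighbours_def fdet_def)
  then have h: "is_farey_parents (mediant 0 1) 0 1" by (rule mediant_farey_parents)
  show ?thesis
    using outer_degree_mediant_least[OF h, of x] outer_degree_half[OF h] assms by simp
qed

section \<open>Levels as level sets of the outer degree\<close>

text \<open>
  Take the one of larger outer degree and its parent on the side of the other fraction. That
  parent cannot lie beyond the other fraction, as outer degrees grow inside a gap between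
  neighbours; so it either is the other fraction or separates the two, and the parent belongs to
  the set because its outer degree is smaller.
\<close>

lemma consecutive_in_neighbours:
  assumes "consecutive_in {x. 0 \<le> x \<and> x \<le> 1 \<and> outer_degree x \<le> m} x y"
  shows "farey_neighbours x y"
proof -
  have x: "0 \<le> x" "x \<le> 1" "outer_degree x \<le> m" and y: "0 \<le> y" "y \<le> 1" "outer_degree y \<le> m"
    and "x < y"
    and sep: "\<And>z. x < z \<Longrightarrow> z < y \<Longrightarrow> m < outer_degree z"
    using assms by (auto simp: consecutive_in_def not_le)
  consider "x = 0" "y = 1" | "outer_degree x \<le> outer_degree y" "y < 1" |
    "outer_degree y \<le> outer_degree x" "0 < x"
    using x y \<open>x < y\<close> outer_degree_ge_4[of x] outer_degree_ge_4[of y] by fastforce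
  then show ?thesis
  proof cases
    case 1
    then show ?thesis by (simp add: farey_neighbours_def fdet_def)
  next
    case 2
    then obtain l r where p: "is_farey_parents y l r"
      using is_farey_parents_ex[of y] x \<open>x < y\<close> by auto
    note q = farey_parents_neighbours[OF p] farey_parents_less[OF p] outer_degree_parent_less[OF p]
    have "\<not> l < x"
      using outer_degree_between[OF x(1,2) q(2)] \<open>x < y\<close> 2 by auto
    moreover have "\<not> x < l" using sep[of l] q y by auto
    ultimately have "l = x" by simp
    then show ?thesis using q(2) by simp
  next
    case 3
    then obtain l r where p: "is_farey_parents x l r"
      using is_farey_parents_ex[of x] y \<open>x < y\<close> by auto
    note q = farey_parents_neighbours[OF p] farey_parents_less[OF p] outer_degree_parent_less[OF p]
    have "\<not> y < r"
      using outer_degree_between[OF y(1,2) q(3)] \<open>x < y\<close> 3 by auto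
    moreover have "\<not> r < y" using sep[of r] q x by auto
    ultimately have "r = y" by simp
    then show ?thesis using q(3) by simp
  qed
qed

lemma mediants_of_consecutive:
  assumes "3 \<le> m"
  shows "{mediant x y | x y. consecutive_in {x. 0 \<le> x \<and> x \<le> 1 \<and> outer_degree x \<le> m} x y} =
    {x. 0 \<le> x \<and> x \<le> 1 \<and> outer_degree x = Suc m}" (is "?A = ?B")
proof (intro equalityI subsetI)
  fix z assume "z \<in> ?A"
  then obtain x y where z: "z = mediant x y"
    and c: "consecutive_in {x. 0 \<le> x \<and> x \<le> 1 \<and> outer_degree x \<le> m} x y" by auto
  have p: "is_farey_parents z x y"
    using mediant_farey_parents[OF consecutive_in_neighbours[OF c]] z by simp
  note q = farey_parents_less[OF p]
  have "m < outer_degree z" using c q by (auto simp: consecutive_in_def not_le)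
  moreover have "outer_degree z \<le> Suc m"
  proof (cases "x = 0 \<and> y = 1")
    case True
    then show ?thesis using outer_degree_half p assms by simp
  next
    case False
    then show ?thesis using outer_degree_mediant(1)[OF p] c by (simp add: consecutive_in_def)
  qed
  ultimately show "z \<in> ?B" using q by auto
next
  fix z assume z: "z \<in> ?B"
  then have "z \<noteq> 0" "z \<noteq> 1" using assms by auto
  then obtain l r where p: "is_farey_parents z l r"
    using is_farey_parents_ex[of z] z by auto
  have "consecutive_in {x. 0 \<le> x \<and> x \<le> 1 \<and> outer_degree x \<le> m} l r"
    using farey_parents_less[OF p] outer_degree_parent_less[OF p]
      outer_degree_mediant_least[OF p] z
    by (fastforce simp: consecutive_in_def)
  then show "z \<in> ?A" using farey_parents_mediant[OF p] by blast
qed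

lemma farey_levels_up_to:
  "(\<Union>m\<in>{1..Suc n}. farey_level m) = {x. 0 \<le> x \<and> x \<le> 1 \<and> outer_degree x \<le> n + 3}"
proof (induction n)
  case 0
  have "x = 0 \<or> x = 1" if "0 \<le> x" "x \<le> 1" "outer_degree x \<le> 3" for x
    using outer_degree_ge_4[of x] that by force
  then show ?case by auto
next
  case (Suc n)
  have "(\<Union>m\<in>{1..Suc (Suc n)}. farey_level m) =
      farey_level (Suc (Suc n)) \<union> (\<Union>m\<in>{1..Suc n}. farey_level m)"
    by (subst atLeastAtMostSuc_conv) auto
  also have "\<dots> = {x. 0 \<le> x \<and> x \<le> 1 \<and> outer_degree x \<le> Suc n + 3}"
    by (simp only: farey_level.simps Suc) (subst mediants_of_consecutive; force)
  finally show ?case .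
qed

lemma farey_level_eq:
  "farey_level (n + 2) = {x. 0 \<le> x \<and> x \<le> 1 \<and> outer_degree x = n + 4}"
proof -
  have "farey_level (n + 2) =
      {mediant x y | x y. consecutive_in {x. 0 \<le> x \<and> x \<le> 1 \<and> outer_degree x \<le> n + 3} x y}"
    by (simp only: add_2_eq_Suc' farey_level.simps farey_levels_up_to)
  also have "\<dots> = {x. 0 \<le> x \<and> x \<le> 1 \<and> outer_degree x = Suc (n + 3)}"
    by (rule mediants_of_consecutive) simp
  also have "Suc (n + 3) = n + 4" by simp
  finally show ?thesis .
qed

section \<open>Children and the order of a level\<close>

definition left_child :: "rat \<Rightarrow> rat" where
  "left_child c = mediant (fst (farey_parents c)) c"

definition right_child :: "rat \<Rightarrow> rat" where
  "right_child c = mediant c (snd (farey_parents c))"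

lemma children_of_mediant:
  assumes "is_farey_parents c l r"
  shows "is_farey_parents (left_child c) l c" "is_farey_parents (right_child c) c r"
proof -
  have "farey_parents c = (l, r)"
    using farey_parents_correct[of c] is_farey_parents_unique[OF assms] farey_parents_less[OF assms]
    by (metis le_less_trans less_le_trans prod.exhaust)
  then show "is_farey_parents (left_child c) l c" "is_farey_parents (right_child c) c r"
    using farey_parents_neighbours[OF assms]
    by (simp_all add: left_child_def right_child_def mediant_farey_parents)
qed

context
  fixes c :: rat
  assumes c: "0 < c" "c < 1"
begin

lemma children_neighbours:
  "farey_neighbours (left_child c) c" "farey_neighbours c (right_child c)"
  using is_farey_parents_ex[OF c] children_of_mediant farey_parents_neighbours by blast+

lemma children_bounds:
  "0 < left_child c" "left_child c < c" "c < right_child c" "right_child c < 1"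
  using is_farey_parents_ex[OF c] children_of_mediant farey_parents_less
  by (meson le_less_trans less_le_trans)+

lemma outer_degree_children:
  "outer_degree (left_child c) = outer_degree c + 1"
  "outer_degree (right_child c) = outer_degree c + 1"
proof -
  obtain l r where p: "is_farey_parents c l r" using is_farey_parents_ex[OF c] by auto
  show "outer_degree (left_child c) = outer_degree c + 1"
    "outer_degree (right_child c) = outer_degree c + 1"
    using outer_degree_mediant(1)[OF children_of_mediant(1)[OF p]]
      outer_degree_mediant(1)[OF children_of_mediant(2)[OF p]]
      outer_degree_parent_less[OF p] c by simp_all
qed

end

text \<open>
  Between a fraction and either of its parents all outer degrees are larger. Hence the right
  parent of \<open>c\<close> lies below \<open>c'\<close>, and in turn not above the left parent of \<open>c'\<close>.
\<close>

lemma children_ordered: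
  assumes "0 < c" "c < c'" "c' < 1" "outer_degree c = outer_degree c'"
  shows "right_child c < left_child c'"
proof -
  obtain l r where p: "is_farey_parents c l r" using is_farey_parents_ex[of c] assms by auto
  obtain l' r' where p': "is_farey_parents c' l' r'" using is_farey_parents_ex[of c'] assms by auto
  note q = farey_parents_less[OF p] outer_degree_parent_less[OF p]
  note q' = farey_parents_less[OF p'] outer_degree_parent_less[OF p']
  have "\<not> c' < r"
    using outer_degree_between[OF _ _ farey_parents_neighbours(3)[OF p], of c'] assms by auto
  then have "r < c'" using q assms(4) by (cases "r = c'") auto
  then have "\<not> l' < r"
    using outer_degree_between[OF _ _ farey_parents_neighbours(2)[OF p'], of r] q assms by auto
  then show ?thesis
    using farey_parents_less(2)[OF children_of_mediant(2)[OF p]]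
      farey_parents_less(1)[OF children_of_mediant(1)[OF p']] by simp
qed

lemma child_cases:
  assumes "0 \<le> x" "x \<le> 1" "outer_degree x = n + 5"
  obtains c where "0 < c" "c < 1" "outer_degree c = n + 4" "x = left_child c \<or> x = right_child c"
proof -
  have "x \<noteq> 0" "x \<noteq> 1" using assms(3) by auto
  then obtain l r where p: "is_farey_parents x l r"
    using is_farey_parents_ex[of x] assms by auto
  have half: "\<not> (l = 0 \<and> r = 1)" using outer_degree_half p assms(3) by auto
  have o: "max (outer_degree l) (outer_degree r) = n + 4"
    using outer_degree_mediant(1)[OF p half] assms(3) by simp
  from farey_parents_neighbours(1)[OF p] show ?thesis
  proof (cases rule: farey_neighbours_cases)
    case unit
    then show ?thesis using half by simp
  next
    case (right s)
    then show ?thesis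
      using o outer_degree_parent_less[OF right] farey_parents_less[OF right]
        farey_parents_mediant[OF p] farey_parents_mediant[OF children_of_mediant(1)[OF right]]
      by (intro that[of r]) auto
  next
    case (left s)
    then show ?thesis
      using o outer_degree_parent_less[OF left] farey_parents_less[OF left]
        farey_parents_mediant[OF p] farey_parents_mediant[OF children_of_mediant(2)[OF left]]
      by (intro that[of l]) auto
  qed
qed

text \<open>The level \<open>n + 2\<close> in increasing order, with the two children of each fraction side by side.\<close>

fun farey_row :: "nat \<Rightarrow> rat list" where
  "farey_row 0 = [mediant 0 1]"
| "farey_row (Suc n) = concat (map (\<lambda>c. [left_child c, right_child c]) (farey_row n))"

lemma length_farey_row: "length (farey_row n) = 2 ^ n"
proof -
  have "length (concat (map (\<lambda>c. [f c, g c]) xs)) = 2 * length xs" for f g :: "rat \<Rightarrow> rat" and xs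
    by (induction xs) auto
  then show ?thesis by (induction n) auto
qed

lemma nth_farey_row:
  assumes "i < 2 ^ n"
  shows "farey_row (Suc n) ! (2 * i) = left_child (farey_row n ! i)"
    and "farey_row (Suc n) ! (2 * i + 1) = right_child (farey_row n ! i)"
proof -
  have "concat (map (\<lambda>c. [f c, g c]) xs) ! (2 * i) = f (xs ! i) \<and>
      concat (map (\<lambda>c. [f c, g c]) xs) ! (2 * i + 1) = g (xs ! i)"
    if "i < length xs" for f g :: "rat \<Rightarrow> rat" and xs i
    using that
  proof (induction xs arbitrary: i)
    case (Cons x xs)
    then show ?case by (cases i) auto
  qed simp
  then show "farey_row (Suc n) ! (2 * i) = left_child (farey_row n ! i)"
    "farey_row (Suc n) ! (2 * i + 1) = right_child (farey_row n ! i)"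
    using assms length_farey_row[of n] by simp_all
qed

lemma set_farey_row: "set (farey_row n) = {x. 0 < x \<and> x < 1 \<and> outer_degree x = n + 4}"
proof (induction n)
  case 0
  have "farey_neighbours 0 1" by (simp add: farey_neighbours_def fdet_def)
  then have h: "is_farey_parents (mediant 0 1) 0 1" by (rule mediant_farey_parents)
  have "x = mediant 0 1" if x: "0 < x" "x < 1" "outer_degree x = 4" for x
  proof -
    obtain l r where p: "is_farey_parents x l r" using is_farey_parents_ex x by blast
    have "l = 0" "r = 1"
      using outer_degree_parent_less[OF p] outer_degree_ge_4[of l] outer_degree_ge_4[of r]
        farey_parents_less[OF p] x by fastforce+
    then show ?thesis using farey_parents_mediant[OF p] by simp
  qed
  moreover have "0 < mediant 0 1" "mediant 0 1 < 1" "outer_degree (mediant 0 1) = 4"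
    using farey_parents_less[OF h] outer_degree_half[OF h] by simp_all
  ultimately have "{x. 0 < x \<and> x < 1 \<and> outer_degree x = 4} = {mediant 0 1}" by blast
  then show ?case by simp
next
  case (Suc n)
  show ?case (is "?A = ?B")
  proof (intro equalityI subsetI)
    fix x assume "x \<in> ?A"
    then obtain c where "c \<in> set (farey_row n)" and x: "x = left_child c \<or> x = right_child c"
      by auto
    then have c: "0 < c" "c < 1" "outer_degree c = n + 4" using Suc by simp_all
    then show "x \<in> ?B" using children_bounds[OF c(1,2)] outer_degree_children[OF c(1,2)] x by auto
  next
    fix x assume "x \<in> ?B"
    then have "0 \<le> x" "x \<le> 1" "outer_degree x = n + 5" by simp_all
    then obtain c where "0 < c" "c < 1" "outer_degree c = n + 4"
      and x: "x = left_child c \<or> x = right_child c"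
      by (rule child_cases)
    then have "c \<in> set (farey_row n)" by (simp add: Suc)
    then show "x \<in> ?A" using x by auto
  qed
qed

lemma sorted_farey_row: "sorted_wrt (<) (farey_row n)"
proof (induction n)
  case (Suc n)
  have "sorted_wrt (<) (concat (map (\<lambda>c. [left_child c, right_child c]) cs))"
    if "sorted_wrt (<) cs" "set cs \<subseteq> {x. 0 < x \<and> x < 1 \<and> outer_degree x = n + 4}" for cs
    using that
  proof (induction cs)
    case (Cons c cs)
    have "left_child c < right_child c" using children_bounds[of c] Cons.prems by auto
    moreover have "right_child c < y" if "y \<in> set (concat (map (\<lambda>c. [left_child c, right_child c]) cs))" for y
    proof -
      obtain d where "d \<in> set cs" "y = left_child d \<or> y = right_child d"
        using \<open>y \<in> _\<close> by auto
      then show ?thesis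
        using children_ordered[of c d] children_bounds[of d] Cons.prems by auto
    qed
    ultimately show ?case using Cons by (auto intro: less_trans)
  qed simp
  then show ?case using Suc set_farey_row[of n] by simp
qed simp

lemma farey_row_eq_level:
  "set (farey_row n) = farey_level (n + 2)"
  "sorted_list_of_set (farey_level (n + 2)) = farey_row n"
proof -
  have "x \<noteq> 0 \<and> x \<noteq> 1" if "outer_degree x = n + 4" for x using that by auto
  then show s: "set (farey_row n) = farey_level (n + 2)"
    by (simp only: set_farey_row farey_level_eq) (auto simp: order.order_iff_strict)
  have "sorted (farey_row n)" "distinct (farey_row n)"
    using sorted_farey_row[of n] by (simp_all add: strict_sorted_iff)
  then show "sorted_list_of_set (farey_level (n + 2)) = farey_row n"
    by (simp only: s[symmetric] sorted_list_of_set.idem_if_sorted_distinct)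
qed

lemma card_farey_level: "card (farey_level (n + 2)) = 2 ^ n"
  using sorted_farey_row[of n] distinct_card[of "farey_row n"]
  by (simp add: strict_sorted_iff farey_row_eq_level length_farey_row)

section \<open>Counting interior nodes\<close>

text \<open>
  Every node created on the way to \<open>x\<close> has a degree below the outer degree of the fraction at
  which it is created, hence below that of \<open>x\<close>.
\<close>

lemma interior_count_eq_0:
  assumes "0 \<le> x" "x \<le> 1" "outer_degree x \<le> k"
  shows "interior_count k x = 0"
  using assms
proof (induction x rule: farey_induct)
  case (mediant x l r)
  note p = mediant.hyps
  have "last_degree l + first_degree r < outer_degree x"
  proof (cases "l = 0 \<and> r = 1")
    case True
    then show ?thesis using outer_degree_half p by simp
  next
    case False
    then show ?thesis
      using outer_degree_mediant[OF p False]
        outer_degree_neighbours_neq[OF farey_parents_neighbours(1)[OF p] False]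
      by linarith
  qed
  then show ?case
    using mediant outer_degree_parent_less[OF p] by (auto simp: interior_count_mediant[OF p])
qed auto

text \<open>
  Both sides of the identity are additive along mediants. The right-hand side is linear in
  numerator and denominator; on the left, a mediant contributes a new node of degree \<open>k\<close> exactly
  when one of its parents has outer degree \<open>k - 1\<close>, and then the corresponding correction term
  disappears, because all outer degrees strictly between \<open>u\<close> and \<open>v\<close> exceed \<open>k\<close>.
\<close>

lemma interior_count_between:
  assumes "0 \<le> y" "y \<le> 1" "farey_neighbours u v" "max (outer_degree u) (outer_degree v) = k"
    and "5 \<le> k" "u \<le> y" "y \<le> v"
  shows "int (interior_count k y) + of_bool (outer_degree y + 1 = k) =
    of_bool (outer_degree v + 1 = k) * fdet u y + of_bool (outer_degree u + 1 = k) * fdet y v"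
proof -
  note uv = assms(3,4)
  have det: "fdet u v = 1" and b: "0 \<le> u" "u \<le> 1" "0 \<le> v" "v \<le> 1"
    using uv farey_neighbours_less[of u v] by (auto simp: farey_neighbours_def)
  have "interior_count k u = 0" "interior_count k v = 0"
    using interior_count_eq_0[OF b(1,2), of k] interior_count_eq_0[OF b(3,4), of k] uv(2) by auto
  then have ends: "int (interior_count k z) + of_bool (outer_degree z + 1 = k) =
      of_bool (outer_degree v + 1 = k) * fdet u z + of_bool (outer_degree u + 1 = k) * fdet z v"
    if "z = u \<or> z = v" for z
    using that det by (elim disjE) simp_all
  show ?thesis
    using assms(1,2,6,7)
  proof (induction y rule: farey_induct)
    case (mediant x l r)
    note p = mediant.hyps
    note q = farey_parents_less[OF p]
    have x01: "0 \<le> x" "x \<le> 1" using q by auto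
    show ?case
    proof (cases "x = u \<or> x = v")
      case True
      then show ?thesis by (rule ends)
    next
      case False
      then have ux: "u < x" "x < v" using mediant.prems by auto
      note between = farey_parents_between[OF uv(1) ux p]
      have IH: "int (interior_count k l) + of_bool (outer_degree l + 1 = k) =
          of_bool (outer_degree v + 1 = k) * fdet u l + of_bool (outer_degree u + 1 = k) * fdet l v"
        "int (interior_count k r) + of_bool (outer_degree r + 1 = k) =
          of_bool (outer_degree v + 1 = k) * fdet u r + of_bool (outer_degree u + 1 = k) * fdet r v"
        using mediant.IH between q ux by auto
      have x: "k < outer_degree x"
        using outer_degree_between[OF x01 uv(1) ux] uv(2) by simp
      have l: "l = u \<or> k < outer_degree l"
        using outer_degree_between[OF _ _ uv(1), of l] between q ux uv(2) by fastforce
      have r: "r = v \<or> k < outer_degree r"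
        using outer_degree_between[OF _ _ uv(1), of r] between q ux uv(2) by fastforce
      have "last_degree l + first_degree r = k \<longleftrightarrow>
          min (outer_degree l) (outer_degree r) + 1 = k"
      proof (cases "l = 0 \<and> r = 1")
        case True
        then show ?thesis using assms(5) by simp
      next
        case False
        then show ?thesis by (simp add: outer_degree_mediant(2)[OF p])
      qed
      then have "of_bool (last_degree l + first_degree r = k) =
          (of_bool (outer_degree l + 1 = k) + of_bool (outer_degree r + 1 = k) :: int)"
        using l r uv(2) by (auto simp: min_def max_def split: if_splits)
      then show ?thesis
        using IH x
        by (simp add: interior_count_mediant[OF p] fdet_mediant[OF p] ring_distribs)
    qed
  next
    case zero
    then show ?case using b by (intro ends) simp
  next
    case one
    then show ?case using b by (intro ends) simp
  qed
qed

text \<open>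
  A fraction of outer degree beyond \<open>k\<close> sits in a gap of the fractions of outer degree at most
  \<open>k\<close>; climbing to the deeper parent as long as that exceeds \<open>k\<close> does not leave the gap.
\<close>

lemma enclosing_neighbours:
  assumes "0 \<le> x" "x \<le> 1" "4 \<le> k" "k < outer_degree x"
  obtains u v where "farey_neighbours u v" "max (outer_degree u) (outer_degree v) = k"
    "u < x" "x < v"
proof -
  have "\<exists>u v. farey_neighbours u v \<and> max (outer_degree u) (outer_degree v) = k \<and> u < x \<and> x < v"
    using assms(1,2,4)
  proof (induction x rule: farey_induct)
    case (mediant x l r)
    note p = mediant.hyps
    note q = farey_parents_less[OF p] farey_parents_neighbours[OF p]
    have "\<not> (l = 0 \<and> r = 1)" using outer_degree_half p mediant.prems assms(3) by auto
    then have o: "k \<le> max (outer_degree l) (outer_degree r)"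
      using outer_degree_mediant(1)[OF p] mediant.prems by simp
    consider "max (outer_degree l) (outer_degree r) = k" | "k < outer_degree l" | "k < outer_degree r"
      using o by linarith
    then show ?case
    proof cases
      case 1
      then show ?thesis using q by blast
    next
      case 2
      then obtain u v where uv: "farey_neighbours u v" "max (outer_degree u) (outer_degree v) = k"
        "u < l" "l < v" using mediant.IH(1) by blast
      have "\<not> v < r"
        using outer_degree_between[OF _ _ q(5), of v] uv 2 farey_neighbours_less[OF uv(1)]
        by (auto simp: farey_neighbours_def)
      then have "u < x" "x < v" using uv q by auto
      then show ?thesis using uv by blast
    next
      case 3
      then obtain u v where uv: "farey_neighbours u v" "max (outer_degree u) (outer_degree v) = k"
        "u < r" "r < v" using mediant.IH(2) by blast
      have "\<not> l < u"
        using outer_degree_between[OF _ _ q(5), of u] uv 3 farey_neighbours_less[OF uv(1)]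
        by (auto simp: farey_neighbours_def)
      then have "u < x" "x < v" using uv q by auto
      then show ?thesis using uv by blast
    qed
  qed (use assms(3) in auto)
  then show ?thesis using that by blast
qed

section \<open>The degree distribution\<close>

lemma fdet_quotient:
  "of_int (fdet a x) / of_int (denom x) = of_int (denom a) * x - of_int (numer a)"
  "of_int (fdet x a) / of_int (denom x) = - of_int (denom a) * x + of_int (numer a)"
proof -
  have "x * of_int (denom x) = of_int (numer x)"
    using rat_eq_numer_denom[of x] denom_pos[of x] by (simp add: field_simps)
  moreover have "(of_int (denom x) :: rat) \<noteq> 0" using denom_pos[of x] by simp
  ultimately show
    "of_int (fdet a x) / of_int (denom x) = of_int (denom a) * x - of_int (numer a)"
    "of_int (fdet x a) / of_int (denom x) = - of_int (denom a) * x + of_int (numer a)"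
    by (simp_all add: fdet_def field_simps)
qed

lemma degree_dist_between:
  assumes "farey_neighbours u v" "max (outer_degree u) (outer_degree v) = k" "5 \<le> k"
    and "u < x" "x < v"
  shows "degree_dist k x = of_int (of_bool (outer_degree v + 1 = k) * fdet u x +
    of_bool (outer_degree u + 1 = k) * fdet x v) / of_int (denom x)"
proof -
  have x: "0 \<le> x" "x \<le> 1" using assms by (auto simp: farey_neighbours_def)
  have "k < outer_degree x" using outer_degree_between[OF x assms(1,4,5)] assms(2) by simp
  then have "int (interior_count k x + of_bool (outer_degree x = k)) =
      of_bool (outer_degree v + 1 = k) * fdet u x + of_bool (outer_degree u + 1 = k) * fdet x v"
    using interior_count_between[OF x assms(1-3)] assms(4,5) by simp
  then show ?thesis
    by (simp only: degree_dist_eq[OF x] of_int_of_nat_eq[symmetric, where 'a = rat])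
qed

context
  fixes c :: rat and k :: nat
  assumes c: "0 < c" "c < 1" and k: "outer_degree c + 1 = k"
begin

lemma degree_dist_left_of:
  assumes "left_child c < x" "x < c"
  shows "degree_dist k x = of_int (denom (left_child c)) * x - of_int (numer (left_child c))"
  using degree_dist_between[OF children_neighbours(1)[OF c], of k x] assms k
    outer_degree_children[OF c] outer_degree_ge_4[OF c] by (simp add: fdet_quotient)

lemma degree_dist_right_of:
  assumes "c < x" "x < right_child c"
  shows "degree_dist k x = - of_int (denom (right_child c)) * x + of_int (numer (right_child c))"
  using degree_dist_between[OF children_neighbours(2)[OF c], of k x] assms k
    outer_degree_children[OF c] outer_degree_ge_4[OF c] by (simp add: fdet_quotient)

end

lemma degree_dist_outer_degree:
  assumes "0 \<le> x" "x \<le> 1" "outer_degree x = k"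
  shows "degree_dist k x = 1 / of_int (denom x)"
  using assms by (simp add: degree_dist_eq interior_count_eq_0)

text \<open>
  Only an end \<open>c\<close> of outer degree \<open>k - 1\<close> of the enclosing gap could make the count nonzero. As
  \<open>x\<close> avoids the intervals from \<open>c\<close> to its children, a child of \<open>c\<close> then lies inside the gap,
  which its outer degree \<open>k\<close> excludes.
\<close>

lemma degree_dist_elsewhere:
  assumes x: "0 \<le> x" "x \<le> 1" and "5 \<le> k" "outer_degree x \<noteq> k"
    and away: "\<And>c. 0 < c \<Longrightarrow> c < 1 \<Longrightarrow> outer_degree c + 1 = k \<Longrightarrow>
      x \<notin> {left_child c<..<c} \<and> x \<notin> {c<..<right_child c}"
  shows "degree_dist k x = 0"
proof (cases "outer_degree x < k")
  case True
  then show ?thesis by (simp add: degree_dist_eq[OF x] interior_count_eq_0[OF x])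
next
  case False
  then obtain u v where uv: "farey_neighbours u v" "max (outer_degree u) (outer_degree v) = k"
    "u < x" "x < v"
    using enclosing_neighbours[OF x, of k] assms(3,4) by auto
  have b: "0 \<le> u" "v \<le> 1" using uv(1) by (auto simp: farey_neighbours_def)
  have gap: "outer_degree z \<noteq> k" if "u < z" "z < v" for z
    using outer_degree_between[OF _ _ uv(1) that] uv(2) b that by auto
  have "outer_degree v + 1 \<noteq> k"
  proof
    assume v: "outer_degree v + 1 = k"
    then have "v \<noteq> 1" using assms(3) by auto
    then have v01: "0 < v" "v < 1" using b uv by auto
    then have "x \<le> left_child v" using away[OF v01 v] uv(4) by auto
    then show False
      using gap[of "left_child v"] uv(3) children_bounds[OF v01] outer_degree_children[OF v01] v
      by auto
  qed
  moreover have "outer_degree u + 1 \<noteq> k"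
  proof
    assume u: "outer_degree u + 1 = k"
    then have "u \<noteq> 0" using assms(3) by auto
    then have u01: "0 < u" "u < 1" using b uv by auto
    then have "right_child u \<le> x" using away[OF u01 u] uv(3) by auto
    then show False
      using gap[of "right_child u"] uv(4) children_bounds[OF u01] outer_degree_children[OF u01] u
      by auto
  qed
  ultimately show ?thesis using degree_dist_between[OF uv(1,2) assms(3) uv(3,4)] by simp
qed

theorem theorem2:
  fixes p q k :: nat and x :: rat
  assumes "q > 0" and "coprime p q" and "x = of_nat p / of_nat q"
    and "x \<in> {0..1/2}" and "k \<ge> 5"
  shows "card (farey_level (k - 3)) = 2 ^ (k - 5) \<and>
     card (farey_level (k - 2)) = 2 ^ (k - 4) \<and>
     (\<forall>i\<in>{1..2 ^ (k - 5)}.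
        farey_frac (k - 2) (2 * i - 1) < farey_frac (k - 3) i \<and>
        farey_frac (k - 3) i < farey_frac (k - 2) (2 * i)) \<and>
     (\<forall>i\<in>{1..2 ^ (k - 5)}.
        x \<in> {farey_frac (k - 2) (2 * i - 1) <..< farey_frac (k - 3) i} \<longrightarrow>
        degree_dist k x =
          of_int (denom (farey_frac (k - 2) (2 * i - 1))) * x
            - of_int (numer (farey_frac (k - 2) (2 * i - 1)))) \<and>
     (\<forall>i\<in>{1..2 ^ (k - 5)}.
        x \<in> {farey_frac (k - 3) i <..< farey_frac (k - 2) (2 * i)} \<longrightarrow>
        degree_dist k x =
          - of_int (denom (farey_frac (k - 2) (2 * i))) * x
            + of_int (numer (farey_frac (k - 2) (2 * i)))) \<and>
     (\<forall>j\<in>{1..2 ^ (k - 4)}.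
        x = farey_frac (k - 2) j \<longrightarrow>
        degree_dist k x = 1 / of_int (denom (farey_frac (k - 2) j))) \<and>
     ((\<forall>i\<in>{1..2 ^ (k - 5)}.
         x \<notin> {farey_frac (k - 2) (2 * i - 1) <..< farey_frac (k - 3) i} \<and>
         x \<notin> {farey_frac (k - 3) i <..< farey_frac (k - 2) (2 * i)}) \<and>
      x \<notin> farey_level (k - 2) \<longrightarrow>
      degree_dist k x = 0)"
proof -
  define n where "n = k - 5"
  have k: "k - 3 = n + 2" "k - 2 = Suc n + 2" "k - 5 = n" "k - 4 = Suc n" and kn: "k = n + 5"
    using \<open>k \<ge> 5\<close> by (simp_all add: n_def)
  have x: "0 \<le> x" "x \<le> 1" using assms(4) by auto
  define c where "c i = farey_frac (k - 3) i" for i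
  have c: "0 < c i" "c i < 1" "outer_degree (c i) + 1 = k"
    and L: "farey_frac (k - 2) (2 * i - 1) = left_child (c i)"
    and R: "farey_frac (k - 2) (2 * i) = right_child (c i)"
    if "i \<in> {1..2 ^ (k - 5)}" for i
  proof -
    have i: "i - 1 < 2 ^ n" "2 * i - 1 - 1 = 2 * (i - 1)" "2 * i - 1 = 2 * (i - 1) + 1"
      using that k(3) by auto
    have ci: "c i = farey_row n ! (i - 1)"
      by (simp only: c_def farey_frac_def k farey_row_eq_level)
    have "c i \<in> set (farey_row n)"
      using i(1) length_farey_row[of n] by (simp add: ci)
    then show "0 < c i" "c i < 1" "outer_degree (c i) + 1 = k"
      by (simp_all add: set_farey_row kn)
    show "farey_frac (k - 2) (2 * i - 1) = left_child (c i)"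
      by (simp only: farey_frac_def k farey_row_eq_level i(2) nth_farey_row[OF i(1)] ci)
    show "farey_frac (k - 2) (2 * i) = right_child (c i)"
      by (simp only: farey_frac_def k farey_row_eq_level i(3) nth_farey_row[OF i(1)] ci)
  qed
  have all_c: "\<exists>i\<in>{1..2 ^ (k - 5)}. d = c i" if "0 < d" "d < 1" "outer_degree d + 1 = k" for d
  proof -
    have "d \<in> set (farey_row n)" using that by (simp add: set_farey_row kn)
    then obtain i where "i < 2 ^ n" "d = farey_row n ! i"
      by (auto simp: in_set_conv_nth length_farey_row)
    then have "Suc i \<in> {1..2 ^ (k - 5)}" "d = c (Suc i)"
      by (simp_all only: c_def farey_frac_def k farey_row_eq_level) auto
    then show ?thesis by blast
  qed
  have row: "farey_frac (k - 2) j \<in> farey_level (k - 2)" if "j \<in> {1..2 ^ (k - 4)}" for j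
  proof -
    have "j - 1 < 2 ^ Suc n" using that by (auto simp: k(4))
    then have "j - 1 < length (farey_row (Suc n))" by (simp only: length_farey_row)
    then have "farey_row (Suc n) ! (j - 1) \<in> farey_level (Suc n + 2)"
      by (simp only: nth_mem flip: farey_row_eq_level(1))
    then show ?thesis by (simp only: farey_frac_def k(2) farey_row_eq_level(2))
  qed
  have level: "farey_level (k - 2) = {x. 0 \<le> x \<and> x \<le> 1 \<and> outer_degree x = k}"
    by (simp only: k(2) farey_level_eq) (auto simp: kn)
  show ?thesis
  proof (intro conjI ballI impI)
    show "card (farey_level (k - 3)) = 2 ^ (k - 5)" "card (farey_level (k - 2)) = 2 ^ (k - 4)"
      by (simp_all only: k card_farey_level)
  next
    fix i assume i: "i \<in> {1..2 ^ (k - 5) :: nat}"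
    show "farey_frac (k - 2) (2 * i - 1) < farey_frac (k - 3) i"
      "farey_frac (k - 3) i < farey_frac (k - 2) (2 * i)"
      using children_bounds[OF c(1,2)[OF i]] by (simp_all only: L[OF i] R[OF i] flip: c_def)
  next
    fix i assume i: "i \<in> {1..2 ^ (k - 5) :: nat}"
      and "x \<in> {farey_frac (k - 2) (2 * i - 1)<..<farey_frac (k - 3) i}"
    then show "degree_dist k x = of_int (denom (farey_frac (k - 2) (2 * i - 1))) * x
        - of_int (numer (farey_frac (k - 2) (2 * i - 1)))"
      using degree_dist_left_of[OF c[OF i], of x] by (simp only: L[OF i] greaterThanLessThan_iff flip: c_def)
  next
    fix i assume i: "i \<in> {1..2 ^ (k - 5) :: nat}"
      and "x \<in> {farey_frac (k - 3) i<..<farey_frac (k - 2) (2 * i)}"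
    then show "degree_dist k x = - of_int (denom (farey_frac (k - 2) (2 * i))) * x
        + of_int (numer (farey_frac (k - 2) (2 * i)))"
      using degree_dist_right_of[OF c[OF i], of x] by (simp only: R[OF i] greaterThanLessThan_iff flip: c_def)
  next
    fix j assume j: "j \<in> {1..2 ^ (k - 4) :: nat}" and xj: "x = farey_frac (k - 2) j"
    have "outer_degree x = k" using row[OF j] by (simp add: xj level)
    then show "degree_dist k x = 1 / of_int (denom (farey_frac (k - 2) j))"
      using degree_dist_outer_degree[OF x] by (simp flip: xj)
  next
    assume out: "(\<forall>i\<in>{1..2 ^ (k - 5)}.
        x \<notin> {farey_frac (k - 2) (2 * i - 1)<..<farey_frac (k - 3) i} \<and>
        x \<notin> {farey_frac (k - 3) i<..<farey_frac (k - 2) (2 * i)}) \<and> x \<notin> farey_level (k - 2)"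
    show "degree_dist k x = 0"
    proof (rule degree_dist_elsewhere[OF x \<open>k \<ge> 5\<close>])
      show "outer_degree x \<noteq> k" using out x by (simp add: level)
      fix d assume "0 < d" "d < 1" "outer_degree d + 1 = k"
      then obtain i where i: "i \<in> {1..2 ^ (k - 5)}" and d: "d = c i" using all_c by blast
      show "x \<notin> {left_child d<..<d} \<and> x \<notin> {d<..<right_child d}"
        using bspec[OF conjunct1[OF out] i] unfolding L[OF i] R[OF i] c_def[symmetric] d .
    qed
  qed
qed

end
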